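(* Suppose that there exists $\beta<1$ such that for all $s\in\mathbb{S}$ $$\sup_{x,y\in\mathbb{X}}d_{\mathrm{tv}}\big(P_s(x,\cdot),P_s(y,\cdot)\big)\le\beta .$$ Suppose that $S_k=s_k$ for all $k\ge0$, where $(s_k)_{k\ge0}$ is a deterministic sequence in $\mathbb{S}$, and let $\varphi:\mathbb{X}\to\mathbb{R}$ be bounded and measurable. Let $g_s(x)=\sum_{k=0}^\infty P_s^k\bar\varphi(x)$, where $\bar\varphi=\varphi-\pi(\varphi)$, and set $$A_n=\sum_{k=1}^n\big[g_{S_k}(X_k)-g_{S_{k-1}}(X_k)\big].$$ Then $A_n/n\to0$ in probability as $n\to\infty$, and therefore the weak law of large numbers holds: $$\frac1n\sum_{k=1}^n\varphi(X_k)\xrightarrow{n\to\infty}\pi(\varphi)\quad\text{in probability.}$$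
   Context: $(\mathbb{X},\mathcal{X})$ and $(\mathbb{S},\mathcal{S})$ are measurable spaces. $\pi$ is a probability measure on $\mathbb{X}$ and $\{P_s\}_{s\in\mathbb{S}}$ is a family of Markov transition probabilities on $\mathbb{X}$, each $\pi$-invariant, such that $(s,x)\mapsto P_s(x,A)$ is $\mathcal{S}\otimes\mathcal{X}$-measurable for all $A\in\mathcal{X}$. $(S_k,X_k)_{k\ge0}$ is an $\mathbb{S}\times\mathbb{X}$-valued stochastic process adapted to a filtration $(\mathcal{F}_k)_{k\ge0}$ such that for all $k\ge0$ and $A\in\mathcal{X}$, $\mathbb{P}(X_{k+1}\in A\mid\mathcal{F}_k)=P_{S_k}(X_k,A)$ a.s. Notation: $\pi(f)=\int f\,d\pi$, $(Pf)(x)=\int P(x,dy)f(y)$, $P^0$ is the identity; $\mathrm{osc}(f)=\sup_xf(x)-\inf_xf(x)$; $d_{\mathrm{tv}}(\mu,\nu)=\sup_A|\mu(A)-\nu(A)|$. The supremum in the hypothesis (the Dobrushin coefficient) also equals $\sup_{\mu\ne\nu}d_{\mathrm{tv}}(\mu P_s,\nu P_s)/d_{\mathrm{tv}}(\mu,\nu)$ over probability measures, and $\sup_{\mathrm{osc}(f)\le1}\mathrm{osc}(P_sf)$ over bounded measurable $f$. Under this hypothesis the series defining $g_s$ converges and $(s,x)\mapsto g_s(x)$ is bounded and measurable. *)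

theory Defs
  imports "HOL-Probability.Probability"
begin

definition tv_dist :: "'x measure \<Rightarrow> 'x measure \<Rightarrow> real" where
  "tv_dist \<mu> \<nu> = (SUP A\<in>sets \<mu>. \<bar>measure \<mu> A - measure \<nu> A\<bar>)"

definition kernel_op :: "('x \<Rightarrow> 'x measure) \<Rightarrow> ('x \<Rightarrow> real) \<Rightarrow> 'x \<Rightarrow> real" where
  "kernel_op K f x = (\<integral>y. f y \<partial>K x)"

text \<open>
  The candidate solution \<open>g\<^sub>s\<close> of the Poisson equation
  \<open>g\<^sub>s - P\<^sub>s g\<^sub>s = \<phi> - \<pi>(\<phi>)\<close>.
  As \<^const>\<open>suminf\<close> is total, the definition is meaningful only where the series converges;
  for bounded measurable \<open>\<phi>\<close> and \<open>\<pi>\<close>-invariant \<open>P s\<close> it does so, geometrically, when the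
  Dobrushin coefficient of \<open>P s\<close> is less than 1.
\<close>

definition poisson_sol ::
    "'x measure \<Rightarrow> ('s \<Rightarrow> 'x \<Rightarrow> 'x measure) \<Rightarrow> ('x \<Rightarrow> real) \<Rightarrow> 's \<Rightarrow> 'x \<Rightarrow> real" where
  "poisson_sol \<pi> P \<phi> s x =
    (\<Sum>k. (kernel_op (P s) ^^ k) (\<lambda>y. \<phi> y - (\<integral>z. \<phi> z \<partial>\<pi>)) x)"

text \<open>
  Convergence in probability to a constant. Measurability is part of the definition because
  \<^const>\<open>measure\<close> is 0 on non-measurable sets.
\<close>

definition conv_in_prob :: "'w measure \<Rightarrow> (nat \<Rightarrow> 'w \<Rightarrow> real) \<Rightarrow> real \<Rightarrow> bool" where
  "conv_in_prob M Z c \<longleftrightarrow>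
    (\<forall>n. Z n \<in> borel_measurable M) \<and>
    (\<forall>\<epsilon>>0. (\<lambda>n. measure M {\<omega>\<in>space M. \<bar>Z n \<omega> - c\<bar> > \<epsilon>}) \<longlonglongrightarrow> 0)"

end

theory Submission
  imports Defs
begin

text \<open>
  If \<open>h\<close> has \<open>\<pi>\<close>-mean zero and oscillation at most \<open>C\<close>, then \<open>P\<^sub>t h\<close> has \<open>\<pi>\<close>-mean zero, by
  invariance, and oscillation at most \<open>\<beta> C\<close>. A function of mean zero is bounded by its oscillation,
  so conditioning on the past shows that \<open>h\<^sub>j(X\<^sub>j)\<close> and \<open>h\<^sub>k(X\<^sub>k)\<close> have covariance at most
  \<open>C\<^sup>2 \<beta>\<^bsup>|k - j|\<^esup>\<close> whenever all \<open>h\<^sub>k\<close> are of this kind. Hence the second moment of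
  \<open>h\<^sub>1(X\<^sub>1) + \<dots> + h\<^sub>n(X\<^sub>n)\<close> is of order \<open>n\<close>, and Chebyshev's inequality gives a weak law of large
  numbers. Apply it to \<open>h\<^sub>k = g\<^bsub>s k\<^esub> - g\<^bsub>s (k - 1)\<^esub>\<close>, which has mean zero as \<open>g\<^sub>t\<close> is a
  geometrically convergent series of such functions, and to \<open>h\<^sub>k = \<phi> - \<pi>(\<phi>)\<close>. In particular
  the law of large numbers for \<open>\<phi>\<close> does not require the Poisson equation.
\<close>

section \<open>Total variation distance and integrals of functions of bounded oscillation\<close>

text \<open>The supremum in \<open>tv_dist\<close> is taken in the reals, so it is an upper bound
  only once the family is known to be bounded; for probability measures 1 is a bound.\<close>

lemma tv_dist_bound:
  assumes "prob_space \<mu>" "prob_space \<nu>" "A \<in> sets \<mu>"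
  shows "\<bar>measure \<mu> A - measure \<nu> A\<bar> \<le> tv_dist \<mu> \<nu>"
  unfolding tv_dist_def
proof (rule cSUP_upper[OF assms(3)])
  show "bdd_above ((\<lambda>A. \<bar>measure \<mu> A - measure \<nu> A\<bar>) ` sets \<mu>)"
    by (rule bdd_aboveI2[of _ _ 1])
      (smt (verit) assms(1,2) measure_nonneg prob_space.prob_le_1)
qed

lemma tv_dist_le_1:
  assumes "prob_space \<mu>" "prob_space \<nu>"
  shows "tv_dist \<mu> \<nu> \<le> 1"
  unfolding tv_dist_def
proof (rule cSUP_least)
  show "\<bar>measure \<mu> A - measure \<nu> A\<bar> \<le> 1" for A
    by (smt (verit) assms measure_nonneg prob_space.prob_le_1)
qed auto

text \<open>The sum counts the positive integers up to \<open>r\<close>. With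
  \<open>r = (h x - m) / \<delta>\<close> it identifies a sum of superlevel indicators with a
  rounded value of \<open>h\<close>.\<close>

lemma sum_threshold_eq_floor:
  fixes r :: real
  assumes "0 \<le> r" "nat \<lfloor>r\<rfloor> \<le> N"
  shows "(\<Sum>i=1..N. of_bool (real i \<le> r)) = real_of_int \<lfloor>r\<rfloor>"
proof -
  have "{i \<in> {1..N}. real i \<le> r} = {1..nat \<lfloor>r\<rfloor>}"
    using assms by (auto simp: le_nat_iff le_floor_iff) linarith
  then show ?thesis
    using assms by (simp add: of_bool_def sum.If_cases Int_def)
qed

text \<open>
  Up to an error \<open>\<delta>\<close>, the function \<open>h - Inf h\<close> is \<open>\<delta>\<close> times a sum of at most \<open>C / \<delta>\<close> indicators
  of superlevel sets.
\<close>

lemma integral_diff_le_tv_dist: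
  fixes h :: "'x \<Rightarrow> real"
  assumes \<mu>: "prob_space \<mu>" and \<nu>: "prob_space \<nu>" "sets \<nu> = sets \<mu>"
    and h: "h \<in> borel_measurable \<mu>"
    and osc: "\<And>x y. x \<in> space \<mu> \<Longrightarrow> y \<in> space \<mu> \<Longrightarrow> \<bar>h x - h y\<bar> \<le> C"
  shows "\<bar>(\<integral>x. h x \<partial>\<mu>) - (\<integral>x. h x \<partial>\<nu>)\<bar> \<le> C * tv_dist \<mu> \<nu>"
proof (rule field_le_epsilon)
  fix e :: real assume "0 < e"
  interpret \<mu>: prob_space \<mu> by fact
  interpret \<nu>: prob_space \<nu> by fact
  note [measurable] = h and [measurable_cong] = \<nu>(2)
  have sp: "space \<nu> = space \<mu>" using \<nu>(2) by (rule sets_eq_imp_space_eq)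
  \<comment> \<open>The rounding error \<open>\<delta>\<close> is paid once for each of the two
    measures.\<close>
  define \<delta> where "\<delta> = e / 2"
  have \<delta>: "\<delta> > 0" using \<open>0 < e\<close> by (simp add: \<delta>_def)
  obtain x0 where x0: "x0 \<in> space \<mu>" using \<mu>.not_empty by blast
  have C: "0 \<le> C" using osc[OF x0 x0] by simp
  define m where "m = (INF x\<in>space \<mu>. h x)"
  have bdd: "bdd_below (h ` space \<mu>)"
    by (rule bdd_belowI2[of _ "h x0 - C"]) (use osc x0 in \<open>force simp: abs_le_iff\<close>)
  have m_le: "m \<le> h x" if "x \<in> space \<mu>" for x
    unfolding m_def using bdd that by (rule cINF_lower)
  have h_le: "h x \<le> m + C" if "x \<in> space \<mu>" for x
  proof -
    have "h x - C \<le> m"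
      unfolding m_def by (rule cINF_greatest) (use osc that x0 in \<open>force simp: abs_le_iff\<close>)+
    then show ?thesis by simp
  qed
  have hb: "\<bar>h x\<bar> \<le> \<bar>m\<bar> + C" if "x \<in> space \<mu>" for x
    using m_le[OF that] h_le[OF that] C by linarith
  \<comment> \<open>Since \<open>(h x - m) / \<delta>\<close> lies between 0 and
    \<open>C / \<delta>\<close>, the set \<open>B i\<close> is empty for \<open>i > N\<close>.
    Moreover \<open>\<delta> * N \<le> C\<close>, which produces the constant \<open>C\<close> at
    the end.\<close>
  define N where "N = nat \<lfloor>C / \<delta>\<rfloor>"
  define B where "B i = {x \<in> space \<mu>. real i \<le> (h x - m) / \<delta>}" for i :: nat
  have B[measurable]: "B i \<in> sets \<mu>" for i unfolding B_def by measurable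
  define v where "v x = m + \<delta> * (\<Sum>i=1..N. indicator (B i) x)" for x
  have v: "\<bar>h x - v x\<bar> \<le> \<delta>" if x: "x \<in> space \<mu>" for x
  proof -
    have "(\<Sum>i=1..N. indicator (B i) x) = (\<Sum>i=1..N. of_bool (real i \<le> (h x - m) / \<delta>) :: real)"
      using x by (intro sum.cong) (auto simp: B_def indicator_def)
    also have "\<dots> = real_of_int \<lfloor>(h x - m) / \<delta>\<rfloor>"
    proof (rule sum_threshold_eq_floor)
      show "nat \<lfloor>(h x - m) / \<delta>\<rfloor> \<le> N"
        unfolding N_def using h_le[OF x] \<delta> by (intro nat_mono floor_mono divide_right_mono) auto
    qed (use m_le[OF x] \<delta> in auto)
    finally have "v x = m + \<delta> * \<lfloor>(h x - m) / \<delta>\<rfloor>" by (simp add: v_def)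
    \<comment> \<open>Rounding down to a multiple of \<open>\<delta>\<close> above \<open>m\<close>
      loses \<open>\<delta>\<close> times a fractional part.\<close>
    then have "h x - v x = \<delta> * frac ((h x - m) / \<delta>)"
      using \<delta> by (simp add: frac_def right_diff_distrib[of \<delta> "_ / _"])
    then show ?thesis
      using \<delta> frac_ge_0[of "(h x - m) / \<delta>"] frac_lt_1[of "(h x - m) / \<delta>"]
      by (simp add: abs_mult)
  qed
  have v_meas[measurable]: "v \<in> borel_measurable \<mu>" unfolding v_def by measurable
  have approx: "\<bar>(\<integral>x. h x \<partial>\<rho>) - (\<integral>x. v x \<partial>\<rho>)\<bar> \<le> \<delta>"
    and int_v: "(\<integral>x. v x \<partial>\<rho>) = m + \<delta> * (\<Sum>i=1..N. measure \<rho> (B i))"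
    if "prob_space \<rho>" and [measurable_cong]: "sets \<rho> = sets \<mu>" for \<rho>
  proof -
    interpret \<rho>: prob_space \<rho> by fact
    have sp: "space \<rho> = space \<mu>" using that(2) by (rule sets_eq_imp_space_eq)
    have int: "integrable \<rho> (\<lambda>x. indicator (B i) x :: real)" for i
      by (intro integrable_real_indicator) (auto simp: less_top[symmetric] that(2))
    have intv: "integrable \<rho> v" unfolding v_def using int by simp
    have inth: "integrable \<rho> h"
      by (rule \<rho>.integrable_const_bound[of _ "\<bar>m\<bar> + C"])
        (use hb sp in \<open>auto intro!: AE_I2\<close>)
    show "(\<integral>x. v x \<partial>\<rho>) = m + \<delta> * (\<Sum>i=1..N. measure \<rho> (B i))"
      unfolding v_def using int by (simp add: \<rho>.prob_space that(2))
    have "\<bar>\<integral>x. h x - v x \<partial>\<rho>\<bar> \<le> (\<integral>x. \<bar>h x - v x\<bar> \<partial>\<rho>)" by (rule integral_abs_bound)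
    also have "\<dots> \<le> (\<integral>x. \<delta> \<partial>\<rho>)"
      using v sp inth intv by (intro integral_mono) auto
    finally show "\<bar>(\<integral>x. h x \<partial>\<rho>) - (\<integral>x. v x \<partial>\<rho>)\<bar> \<le> \<delta>"
      using inth intv by (simp add: \<rho>.prob_space)
  qed
  have tv0: "0 \<le> tv_dist \<mu> \<nu>"
    using tv_dist_bound[OF \<mu> \<nu>(1), of "{}"] by simp
  \<comment> \<open>The constant \<open>m\<close> cancels because both measures have mass 1, and
    each of the \<open>N\<close> superlevel sets contributes at most
    \<open>\<delta> * tv_dist \<mu> \<nu>\<close>.\<close>
  have "\<bar>(\<integral>x. v x \<partial>\<mu>) - (\<integral>x. v x \<partial>\<nu>)\<bar>
      = \<delta> * \<bar>\<Sum>i=1..N. measure \<mu> (B i) - measure \<nu> (B i)\<bar>"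
    using \<delta> by (simp add: int_v[OF \<mu> refl] int_v[OF \<nu>] sum_subtractf abs_mult
        flip: right_diff_distrib)
  also have "\<dots> \<le> \<delta> * (\<Sum>i=1..N. tv_dist \<mu> \<nu>)"
    using \<delta> by (intro mult_left_mono order_trans[OF sum_abs] sum_mono tv_dist_bound \<mu> \<nu>(1) B) auto
  also have "\<dots> = (\<delta> * N) * tv_dist \<mu> \<nu>" by simp
  also have "\<dots> \<le> C * tv_dist \<mu> \<nu>"
  proof (rule mult_right_mono[OF _ tv0])
    have "real N \<le> C / \<delta>" using C \<delta> by (simp add: N_def)
    then show "\<delta> * N \<le> C" using \<delta> by (simp add: field_simps)
  qed
  finally show "\<bar>(\<integral>x. h x \<partial>\<mu>) - (\<integral>x. h x \<partial>\<nu>)\<bar> \<le> C * tv_dist \<mu> \<nu> + e"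
    using approx[OF \<mu> refl] approx[OF \<nu>] unfolding \<delta>_def by linarith
qed


section \<open>Mean-zero functions of bounded oscillation\<close>

text \<open>\<open>C\<close> bounds the oscillation and not the sup norm, because oscillation is
  what the kernels contract. Mean zero is taken under the common invariant measure, so it survives
  the application of different kernels in succession.\<close>

definition centred :: "'x measure \<Rightarrow> real \<Rightarrow> ('x \<Rightarrow> real) \<Rightarrow> bool" where
  "centred \<pi> C h \<longleftrightarrow> h \<in> borel_measurable \<pi> \<and>
    (\<forall>x\<in>space \<pi>. \<forall>y\<in>space \<pi>. \<bar>h x - h y\<bar> \<le> C) \<and> (\<integral>x. h x \<partial>\<pi>) = 0"

context prob_space
begin

lemma centredD:
  assumes "centred M C h"
  shows centred_measurable: "h \<in> borel_measurable M"
    and centred_osc: "\<And>x y. x \<in> space M \<Longrightarrow> y \<in> space M \<Longrightarrow> \<bar>h x - h y\<bar> \<le> C"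
    and centred_integral: "(\<integral>x. h x \<partial>M) = 0"
  using assms by (auto simp: centred_def)

text \<open>The integral of a non-integrable function is 0 by default, so the mean condition alone
  says nothing about integrability. The oscillation bound does: it makes \<open>h\<close> bounded on
  a probability space.\<close>

lemma centred_integrable:
  assumes "centred M C h"
  shows "integrable M h"
proof -
  obtain x0 where x0: "x0 \<in> space M" using not_empty by blast
  show ?thesis
  proof (rule integrable_const_bound[OF AE_I2])
    show "norm (h x) \<le> \<bar>h x0\<bar> + C" if "x \<in> space M" for x
      using centred_osc[OF assms that x0] by simp
  qed (rule centred_measurable[OF assms])
qed

text \<open>Mean zero gives \<open>h x\<close> as the average of \<open>h x - h y\<close> over
  \<open>y\<close>, and each such difference is at most \<open>C\<close> in absolute value.\<close>

lemma centred_abs_le: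
  assumes h: "centred M C h" and x: "x \<in> space M"
  shows "\<bar>h x\<bar> \<le> C"
proof -
  have "\<bar>h x\<bar> = \<bar>\<integral>y. h x - h y \<partial>M\<bar>"
    using centred_integrable[OF h] by (simp add: prob_space centred_integral[OF h])
  also have "\<dots> \<le> (\<integral>y. \<bar>h x - h y\<bar> \<partial>M)" by (rule integral_abs_bound)
  also have "\<dots> \<le> (\<integral>y. C \<partial>M)"
    using centred_integrable[OF h] centred_osc[OF h x] by (intro integral_mono) auto
  finally show ?thesis by (simp add: prob_space)
qed

lemma centred_nonneg: "centred M C h \<Longrightarrow> 0 \<le> C"
  using not_empty centred_abs_le by (meson abs_ge_zero all_not_in_conv order_trans)

lemma centred_diff:
  assumes f: "centred M B f" and g: "centred M C g"
  shows "centred M (B + C) (\<lambda>x. f x - g x)"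
  unfolding centred_def
proof (intro conjI ballI)
  show "(\<lambda>x. f x - g x) \<in> borel_measurable M"
    using centred_measurable[OF f] centred_measurable[OF g] by measurable
  show "\<bar>f x - g x - (f y - g y)\<bar> \<le> B + C" if "x \<in> space M" "y \<in> space M" for x y
    using centred_osc[OF f that] centred_osc[OF g that] by linarith
  show "(\<integral>x. f x - g x \<partial>M) = 0"
    using centred_integral[OF f] centred_integral[OF g]
      centred_integrable[OF f] centred_integrable[OF g] by simp
qed

text \<open>The geometric series with terms \<open>C * \<beta> ^ k\<close> dominates both the values
  and the oscillations of the \<open>h k\<close>; this gives convergence, the oscillation bound, and
  the exchange of sum and integral. The use is for the series defining
  \<open>poisson_sol\<close>.\<close>

lemma centred_suminf:
  fixes \<beta> :: real
  assumes h: "\<And>k. centred M (C * \<beta> ^ k) (h k)" and \<beta>: "0 \<le> \<beta>" "\<beta> < 1"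
  shows "centred M (C / (1 - \<beta>)) (\<lambda>x. \<Sum>k. h k x)"
proof -
  have geo: "(\<lambda>k. C * \<beta> ^ k) sums (C / (1 - \<beta>))"
    using sums_mult[OF geometric_sums, of \<beta> C] \<beta> by simp
  have sum_abs: "summable (\<lambda>k. \<bar>h k x\<bar>)" if "x \<in> space M" for x
    by (rule summable_comparison_test'[OF sums_summable[OF geo], of 0])
      (use centred_abs_le[OF h that] in auto)
  have sum: "summable (\<lambda>k. h k x)" if "x \<in> space M" for x
    by (rule summable_rabs_cancel) (rule sum_abs[OF that])
  note [measurable] = centred_measurable[OF h]
  note int = centred_integrable[OF h]
  have abs_int: "(\<integral>x. \<bar>h k x\<bar> \<partial>M) \<le> C * \<beta> ^ k" for k
    using integral_mono[of M "\<lambda>x. \<bar>h k x\<bar>" "\<lambda>x. C * \<beta> ^ k"] int centred_abs_le[OF h]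
    by (simp add: prob_space)
  show ?thesis
    unfolding centred_def
  proof (intro conjI ballI)
    show "(\<lambda>x. \<Sum>k. h k x) \<in> borel_measurable M" by measurable
    show "\<bar>(\<Sum>k. h k x) - (\<Sum>k. h k y)\<bar> \<le> C / (1 - \<beta>)" if "x \<in> space M" "y \<in> space M" for x y
    proof -
      have s: "summable (\<lambda>k. \<bar>h k x - h k y\<bar>)"
        by (rule summable_comparison_test'[OF sums_summable[OF geo], of 0])
          (use centred_osc[OF h that] in auto)
      have "\<bar>(\<Sum>k. h k x) - (\<Sum>k. h k y)\<bar> = \<bar>\<Sum>k. h k x - h k y\<bar>"
        using sum that by (simp add: suminf_diff)
      also have "\<dots> \<le> (\<Sum>k. \<bar>h k x - h k y\<bar>)" using s by (rule summable_rabs)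
      also have "\<dots> \<le> (\<Sum>k. C * \<beta> ^ k)"
        using centred_osc[OF h that] s sums_summable[OF geo] by (intro suminf_le) auto
      finally show ?thesis using sums_unique[OF geo] by simp
    qed
    have "(\<integral>x. (\<Sum>k. h k x) \<partial>M) = (\<Sum>k. \<integral>x. h k x \<partial>M)"
    proof (rule integral_suminf[OF int])
      show "AE x in M. summable (\<lambda>k. norm (h k x))" using sum_abs by (intro AE_I2) simp
      show "summable (\<lambda>k. \<integral>x. norm (h k x) \<partial>M)"
        by (rule summable_comparison_test'[OF sums_summable[OF geo], of 0])
          (use abs_int in simp)
    qed
    then show "(\<integral>x. (\<Sum>k. h k x) \<partial>M) = 0"
      by (simp add: centred_integral[OF h])
  qed
qed

end

section \<open>Dobrushin contraction for one invariant kernel\<close>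

locale contracting_kernel = prob_space \<pi> for \<pi> :: "'x measure" +
  fixes K :: "'x \<Rightarrow> 'x measure" and \<beta> :: real
  assumes kernel_measurable[measurable]: "K \<in> \<pi> \<rightarrow>\<^sub>M prob_algebra \<pi>"
    and invariant: "\<pi> \<bind> K = \<pi>"
    and tv_dist_le: "\<And>x y. x \<in> space \<pi> \<Longrightarrow> y \<in> space \<pi> \<Longrightarrow> tv_dist (K x) (K y) \<le> \<beta>"
    and less_1: "\<beta> < 1"
begin

lemma kernel_measurable_subprob[measurable]: "K \<in> \<pi> \<rightarrow>\<^sub>M subprob_algebra \<pi>"
  by (rule measurable_prob_algebraD) (rule kernel_measurable)

lemma prob_space_kernel: "x \<in> space \<pi> \<Longrightarrow> prob_space (K x)"
  and sets_kernel: "x \<in> space \<pi> \<Longrightarrow> sets (K x) = sets \<pi>"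
  and space_kernel: "x \<in> space \<pi> \<Longrightarrow> space (K x) = space \<pi>"
  using measurable_space[OF kernel_measurable, of x]
  by (auto simp: space_prob_algebra dest: sets_eq_imp_space_eq)

lemma nonneg: "0 \<le> \<beta>"
proof -
  obtain x where x: "x \<in> space \<pi>" using not_empty by blast
  show ?thesis
    using tv_dist_bound[OF prob_space_kernel[OF x] prob_space_kernel[OF x], of "{}"] tv_dist_le[OF x x]
    by simp
qed

lemma kernel_op_measurable:
  "h \<in> borel_measurable \<pi> \<Longrightarrow> kernel_op K h \<in> borel_measurable \<pi>"
  unfolding kernel_op_def
  by (rule measurable_compose[OF kernel_measurable_subprob integral_measurable_subprob_algebra])

text \<open>Two values of \<open>kernel_op K h\<close> are integrals of \<open>h\<close> against
  \<open>K x\<close> and \<open>K y\<close>, so they differ by at most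
  \<open>C * tv_dist (K x) (K y)\<close>. The mean is that of \<open>h\<close> under
  \<open>\<pi> \<bind> K\<close>, which is \<open>\<pi>\<close>.\<close>

lemma centred_kernel_op:
  assumes h: "centred \<pi> C h"
  shows "centred \<pi> (C * \<beta>) (kernel_op K h)"
  unfolding centred_def
proof (intro conjI ballI)
  show "kernel_op K h \<in> borel_measurable \<pi>"
    by (rule kernel_op_measurable) (rule centred_measurable[OF h])
  show "\<bar>kernel_op K h x - kernel_op K h y\<bar> \<le> C * \<beta>" if x: "x \<in> space \<pi>" and y: "y \<in> space \<pi>" for x y
  proof -
    have "\<bar>kernel_op K h x - kernel_op K h y\<bar> \<le> C * tv_dist (K x) (K y)"
      unfolding kernel_op_def
      using x y centred_osc[OF h] centred_measurable[OF h]
      by (intro integral_diff_le_tv_dist prob_space_kernel)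
        (simp_all add: sets_kernel space_kernel cong: measurable_cong_sets)
    also have "\<dots> \<le> C * \<beta>"
      using tv_dist_le[OF x y] centred_nonneg[OF h] by (rule mult_left_mono)
    finally show ?thesis .
  qed
  have "(\<integral>x. kernel_op K h x \<partial>\<pi>) = (\<integral>x. h x \<partial>(\<pi> \<bind> K))"
    unfolding kernel_op_def
    by (rule integral_bind[symmetric, OF centred_measurable[OF h] centred_abs_le[OF h]
          kernel_measurable_subprob, where B' = 1])
      (auto intro!: finite_measure_axioms AE_I2 simp: prob_space.emeasure_space_1[OF prob_space_kernel])
  then show "(\<integral>x. kernel_op K h x \<partial>\<pi>) = 0"
    by (simp add: invariant centred_integral[OF h])
qed

lemma centred_kernel_op_funpow:
  "centred \<pi> C h \<Longrightarrow> centred \<pi> (C * \<beta> ^ k) ((kernel_op K ^^ k) h)"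
proof (induction k)
  case (Suc k)
  then show ?case
    using centred_kernel_op[OF Suc.IH] by (simp add: mult.commute mult.left_commute)
qed simp

end


section \<open>Time-inhomogeneous chains with a common invariant measure\<close>

text \<open>With a deterministic parameter sequence the process is a time-inhomogeneous Markov
  chain, so the kernels are indexed by time: \<open>K k\<close> leads from \<open>X k\<close> to
  \<open>X (Suc k)\<close>. No law is prescribed for \<open>X 0\<close>; in particular the chain may
  start away from \<open>\<pi>\<close>.\<close>

locale contracting_chain = prob_space M for M :: "'w measure" +
  fixes \<pi> :: "'x measure" and K :: "nat \<Rightarrow> 'x \<Rightarrow> 'x measure" and \<beta> :: real
    and F :: "nat \<Rightarrow> 'w measure" and X :: "nat \<Rightarrow> 'w \<Rightarrow> 'x"
  assumes contracting: "\<And>k. contracting_kernel \<pi> (K k) \<beta>"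
    and filtration: "filtration (space M) F"
    and subalgebra: "\<And>k. subalgebra M (F k)"
    and adapted: "\<And>k. X k \<in> F k \<rightarrow>\<^sub>M \<pi>"
    and transition: "\<And>k B. B \<in> sets \<pi> \<Longrightarrow>
      AE \<omega> in M. real_cond_exp M (F k) (\<lambda>\<omega>. indicator B (X (Suc k) \<omega>)) \<omega>
        = measure (K k (X k \<omega>)) B"
begin

sublocale kernel: contracting_kernel \<pi> "K k" \<beta> for k
  by (rule contracting)

lemma X_measurable[measurable]: "X k \<in> M \<rightarrow>\<^sub>M \<pi>"
  using subalgebra adapted by (rule measurable_from_subalg)

lemma X_in_space: "\<omega> \<in> space M \<Longrightarrow> X k \<omega> \<in> space \<pi>"
  using X_measurable by (rule measurable_space)

lemma bounded_integrable:
  fixes f :: "'w \<Rightarrow> real"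
  assumes "f \<in> borel_measurable M" "\<And>\<omega>. \<omega> \<in> space M \<Longrightarrow> \<bar>f \<omega>\<bar> \<le> B"
  shows "integrable M f"
  using assms by (intro integrable_const_bound[of _ B]) auto

text \<open>This is the characteristic property of conditional expectation with an
  \<open>F k\<close>-measurable weight \<open>Z\<close>. Boundedness of \<open>Z\<close> makes the
  real integrals exist; nonnegativity turns them into nonnegative integrals, the form used to
  compare measures of sets.\<close>

lemma nn_integral_transition:
  fixes Z :: "'w \<Rightarrow> real"
  assumes Z: "Z \<in> borel_measurable (F k)"
    and Z_nonneg: "\<And>\<omega>. \<omega> \<in> space M \<Longrightarrow> 0 \<le> Z \<omega>"
    and Z_le: "\<And>\<omega>. \<omega> \<in> space M \<Longrightarrow> Z \<omega> \<le> D"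
    and B[measurable]: "B \<in> sets \<pi>"
  shows "(\<integral>\<^sup>+\<omega>. ennreal (Z \<omega>) * indicator B (X (Suc k) \<omega>) \<partial>M)
    = (\<integral>\<^sup>+\<omega>. ennreal (Z \<omega>) * emeasure (K k (X k \<omega>)) B \<partial>M)"
proof -
  interpret finite_measure_subalgebra M "F k"
    by unfold_locales (rule subalgebra)
  have Z_M[measurable]: "Z \<in> borel_measurable M"
    using subalgebra Z by (rule measurable_from_subalg)
  have meas[measurable]: "(\<lambda>\<omega>. measure (K k (X k \<omega>)) B) \<in> borel_measurable M"
    by measurable
  have le_1: "measure (K k (X k \<omega>)) B \<le> 1" if "\<omega> \<in> space M" for \<omega>
    by (rule prob_space.prob_le_1[OF kernel.prob_space_kernel[OF X_in_space[OF that]]])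
  have abs_Z: "\<bar>Z \<omega>\<bar> \<le> D" if "\<omega> \<in> space M" for \<omega>
    using Z_nonneg[OF that] Z_le[OF that] by simp
  have int1: "integrable M (\<lambda>\<omega>. Z \<omega> * indicator B (X (Suc k) \<omega>))"
    by (rule bounded_integrable[where B = D])
      (use abs_Z in \<open>auto simp: indicator_def intro: order_trans[OF abs_ge_zero]\<close>)
  have int2: "integrable M (\<lambda>\<omega>. Z \<omega> * measure (K k (X k \<omega>)) B)"
  proof (rule bounded_integrable[where B = D])
    show "\<bar>Z \<omega> * measure (K k (X k \<omega>)) B\<bar> \<le> D" if "\<omega> \<in> space M" for \<omega>
      using mult_mono[OF abs_Z[OF that] le_1[OF that]] abs_Z[OF that] by (simp add: abs_mult)
  qed measurable
  have "(\<integral>\<^sup>+\<omega>. ennreal (Z \<omega>) * indicator B (X (Suc k) \<omega>) \<partial>M)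
      = (\<integral>\<^sup>+\<omega>. ennreal (Z \<omega> * indicator B (X (Suc k) \<omega>)) \<partial>M)"
    by (intro nn_integral_cong) (simp add: indicator_def)
  also have "\<dots> = ennreal (\<integral>\<omega>. Z \<omega> * indicator B (X (Suc k) \<omega>) \<partial>M)"
    using int1 Z_nonneg by (intro nn_integral_eq_integral) (auto intro!: AE_I2)
  also have "(\<integral>\<omega>. Z \<omega> * indicator B (X (Suc k) \<omega>) \<partial>M)
      = (\<integral>\<omega>. Z \<omega> * real_cond_exp M (F k) (\<lambda>\<omega>. indicator B (X (Suc k) \<omega>)) \<omega> \<partial>M)"
    by (rule real_cond_exp_intg(2)[symmetric, OF int1 Z]) measurable
  also have "\<dots> = (\<integral>\<omega>. Z \<omega> * measure (K k (X k \<omega>)) B \<partial>M)"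
    using transition[OF B, of k] by (intro integral_cong_AE) (measurable, auto)
  also have "ennreal \<dots> = (\<integral>\<^sup>+\<omega>. ennreal (Z \<omega> * measure (K k (X k \<omega>)) B) \<partial>M)"
    using int2 Z_nonneg by (intro nn_integral_eq_integral[symmetric]) (auto intro!: AE_I2)
  also have "\<dots> = (\<integral>\<^sup>+\<omega>. ennreal (Z \<omega>) * emeasure (K k (X k \<omega>)) B \<partial>M)"
  proof (rule nn_integral_cong)
    fix \<omega> assume \<omega>: "\<omega> \<in> space M"
    interpret K: prob_space "K k (X k \<omega>)"
      by (rule kernel.prob_space_kernel[OF X_in_space[OF \<omega>]])
    show "ennreal (Z \<omega> * measure (K k (X k \<omega>)) B) = ennreal (Z \<omega>) * emeasure (K k (X k \<omega>)) B"
      using Z_nonneg[OF \<omega>] by (simp add: K.emeasure_eq_measure ennreal_mult)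
  qed
  finally show ?thesis .
qed

text \<open>
  For \<open>Z \<ge> 0\<close> both sides are integrals of \<open>h\<close>: against the law of \<open>X (Suc k)\<close> under the measure
  \<open>Z dM\<close>, and against the law of \<open>X k\<close> under \<open>Z dM\<close> followed by \<open>K k\<close>.
\<close>

lemma integral_transition_nonneg:
  fixes Z :: "'w \<Rightarrow> real" and h :: "'x \<Rightarrow> real"
  assumes Z: "Z \<in> borel_measurable (F k)"
    and Z_nonneg: "\<And>\<omega>. \<omega> \<in> space M \<Longrightarrow> 0 \<le> Z \<omega>"
    and Z_le: "\<And>\<omega>. \<omega> \<in> space M \<Longrightarrow> Z \<omega> \<le> D"
    and h[measurable]: "h \<in> borel_measurable \<pi>"
    and h_bounded: "\<And>x. x \<in> space \<pi> \<Longrightarrow> \<bar>h x\<bar> \<le> C"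
  shows "(\<integral>\<omega>. Z \<omega> * h (X (Suc k) \<omega>) \<partial>M) = (\<integral>\<omega>. Z \<omega> * kernel_op (K k) h (X k \<omega>) \<partial>M)"
proof -
  have Z_M[measurable]: "Z \<in> borel_measurable M"
    using subalgebra Z by (rule measurable_from_subalg)
  note kernel.kernel_op_measurable[OF h, measurable]
  define \<nu> where "\<nu> = density M (\<lambda>\<omega>. ennreal (Z \<omega>))"
  have X_\<nu>[measurable]: "X j \<in> \<nu> \<rightarrow>\<^sub>M \<pi>" for j
    using X_measurable[of j] by (simp add: \<nu>_def)
  \<comment> \<open>The total mass is at most \<open>D\<close>; finiteness is what
    \<open>integral_bind\<close> requires of the image \<open>\<mu>\<close>.\<close>
  have "emeasure \<nu> (space \<nu>) = (\<integral>\<^sup>+\<omega>. ennreal (Z \<omega>) \<partial>M)"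
    by (simp add: \<nu>_def emeasure_density cong: nn_integral_cong)
  also have "\<dots> \<le> (\<integral>\<^sup>+\<omega>. ennreal D \<partial>M)"
    using Z_le by (intro nn_integral_mono ennreal_leI)
  also have "\<dots> < \<infinity>" by (simp add: emeasure_space_1)
  finally have fin: "finite_measure \<nu>" by (intro finite_measureI) simp
  define \<mu> where "\<mu> = distr \<nu> \<pi> (X k)"
  have K_\<mu>[measurable]: "K k \<in> \<mu> \<rightarrow>\<^sub>M subprob_algebra \<pi>"
    unfolding \<mu>_def by simp
  have \<mu>_ne: "space \<mu> \<noteq> {}"
    using kernel.not_empty by (simp add: \<mu>_def)
  have "distr \<nu> \<pi> (X (Suc k)) = \<mu> \<bind> K k"
  proof (rule measure_eqI)
    show "sets (distr \<nu> \<pi> (X (Suc k))) = sets (\<mu> \<bind> K k)"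
      using \<mu>_ne by (subst sets_bind[where N = \<pi>]) (auto simp: kernel.sets_kernel \<mu>_def)
    fix B assume "B \<in> sets (distr \<nu> \<pi> (X (Suc k)))"
    then have B[measurable]: "B \<in> sets \<pi>" by simp
    have "emeasure (distr \<nu> \<pi> (X (Suc k))) B = (\<integral>\<^sup>+\<omega>. indicator B (X (Suc k) \<omega>) \<partial>\<nu>)"
      by (subst nn_integral_distr[where f = "indicator B", symmetric, OF X_\<nu>]) simp_all
    also have "\<dots> = (\<integral>\<^sup>+\<omega>. ennreal (Z \<omega>) * indicator B (X (Suc k) \<omega>) \<partial>M)"
      unfolding \<nu>_def by (rule nn_integral_density) measurable
    also have "\<dots> = (\<integral>\<^sup>+\<omega>. ennreal (Z \<omega>) * emeasure (K k (X k \<omega>)) B \<partial>M)"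
      using Z Z_nonneg Z_le B by (rule nn_integral_transition)
    also have "\<dots> = (\<integral>\<^sup>+\<omega>. emeasure (K k (X k \<omega>)) B \<partial>\<nu>)"
      unfolding \<nu>_def by (rule nn_integral_density[symmetric]) measurable
    also have "\<dots> = (\<integral>\<^sup>+x. emeasure (K k x) B \<partial>\<mu>)"
      unfolding \<mu>_def by (rule nn_integral_distr[symmetric]) measurable
    also have "\<dots> = emeasure (\<mu> \<bind> K k) B"
      by (rule emeasure_bind[symmetric, OF \<mu>_ne K_\<mu> B])
    finally show "emeasure (distr \<nu> \<pi> (X (Suc k))) B = emeasure (\<mu> \<bind> K k) B" .
  qed
  then have "(\<integral>x. h x \<partial>distr \<nu> \<pi> (X (Suc k))) = (\<integral>x. h x \<partial>(\<mu> \<bind> K k))" by simp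
  also have "\<dots> = (\<integral>x. kernel_op (K k) h x \<partial>\<mu>)"
    unfolding kernel_op_def
    by (rule integral_bind[OF h h_bounded K_\<mu>, where B' = 1])
      (auto intro!: AE_I2 finite_measure.finite_measure_distr[OF fin]
        simp: \<mu>_def prob_space.emeasure_space_1[OF kernel.prob_space_kernel])
  finally show ?thesis
    using Z_nonneg
    by (simp add: \<mu>_def integral_distr)
      (simp add: \<nu>_def integral_density AE_I2)
qed

text \<open>A signed weight is the difference of the nonnegative bounded weights
  \<open>Z + D\<close> and \<open>D\<close>, and the identity holds for each of these.\<close>

lemma integral_transition:
  fixes Z :: "'w \<Rightarrow> real" and h :: "'x \<Rightarrow> real"
  assumes Z: "Z \<in> borel_measurable (F k)"
    and Z_bounded: "\<And>\<omega>. \<omega> \<in> space M \<Longrightarrow> \<bar>Z \<omega>\<bar> \<le> D"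
    and h: "centred \<pi> C h"
  shows "(\<integral>\<omega>. Z \<omega> * h (X (Suc k) \<omega>) \<partial>M) = (\<integral>\<omega>. Z \<omega> * kernel_op (K k) h (X k \<omega>) \<partial>M)"
proof -
  note Kh = kernel.centred_kernel_op[OF h, of k]
  note [measurable] = kernel.centred_measurable[OF h] kernel.centred_measurable[OF Kh]
    measurable_from_subalg[OF subalgebra Z]
  have int: "integrable M (\<lambda>\<omega>. f (X j \<omega>))" "integrable M (\<lambda>\<omega>. Z \<omega> * f (X j \<omega>))"
    if f: "centred \<pi> B f" for B f j
  proof -
    note [measurable] = kernel.centred_measurable[OF f]
    show "integrable M (\<lambda>\<omega>. f (X j \<omega>))"
      using kernel.centred_abs_le[OF f] X_in_space by (intro bounded_integrable[where B = B]) auto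
    show "integrable M (\<lambda>\<omega>. Z \<omega> * f (X j \<omega>))"
    proof (rule bounded_integrable[where B = "D * B"])
      show "\<bar>Z \<omega> * f (X j \<omega>)\<bar> \<le> D * B" if "\<omega> \<in> space M" for \<omega>
        unfolding abs_mult using Z_bounded[OF that] kernel.centred_abs_le[OF f X_in_space[OF that]]
        by (intro mult_mono) auto
    qed measurable
  qed
  have split: "(\<integral>\<omega>. (Z \<omega> + D) * f (X j \<omega>) \<partial>M)
      = (\<integral>\<omega>. Z \<omega> * f (X j \<omega>) \<partial>M) + (\<integral>\<omega>. D * f (X j \<omega>) \<partial>M)"
    if "centred \<pi> B f" for B f j
    using int[OF that] by (simp add: distrib_right)
  have D: "(\<integral>\<omega>. D * h (X (Suc k) \<omega>) \<partial>M) = (\<integral>\<omega>. D * kernel_op (K k) h (X k \<omega>) \<partial>M)"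
  proof (rule integral_transition_nonneg[OF _ _ _ _ kernel.centred_abs_le[OF h]])
    show "0 \<le> D" if "\<omega> \<in> space M" for \<omega> using Z_bounded[OF that] by simp
  qed auto
  have "(\<integral>\<omega>. (Z \<omega> + D) * h (X (Suc k) \<omega>) \<partial>M) = (\<integral>\<omega>. (Z \<omega> + D) * kernel_op (K k) h (X k \<omega>) \<partial>M)"
  proof (rule integral_transition_nonneg[OF _ _ _ _ kernel.centred_abs_le[OF h]])
    show "0 \<le> Z \<omega> + D" "Z \<omega> + D \<le> 2 * D" if "\<omega> \<in> space M" for \<omega>
      using Z_bounded[OF that] by auto
  qed (use Z in auto)
  then show ?thesis
    unfolding split[OF h] split[OF Kh] D by simp
qed

text \<open>Conditioning on time \<open>j + m\<close> replaces \<open>h\<close> at time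
  \<open>j + Suc m\<close> by \<open>kernel_op (K (j + m)) h\<close> at time \<open>j + m\<close>,
  whose constant is \<open>C * \<beta>\<close>. The induction therefore has to be general in
  \<open>h\<close> and \<open>C\<close>.\<close>

lemma correlation_decay:
  fixes Z :: "'w \<Rightarrow> real" and h :: "'x \<Rightarrow> real"
  assumes Z: "Z \<in> borel_measurable (F j)"
    and Z_bounded: "\<And>\<omega>. \<omega> \<in> space M \<Longrightarrow> \<bar>Z \<omega>\<bar> \<le> D"
    and h: "centred \<pi> C h"
  shows "\<bar>\<integral>\<omega>. Z \<omega> * h (X (j + m) \<omega>) \<partial>M\<bar> \<le> D * C * \<beta> ^ m"
  using h
proof (induction m arbitrary: C h)
  case 0
  note [measurable] = kernel.centred_measurable[OF 0] measurable_from_subalg[OF subalgebra Z]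
  have le: "\<bar>Z \<omega> * h (X j \<omega>)\<bar> \<le> D * C" if "\<omega> \<in> space M" for \<omega>
    unfolding abs_mult using Z_bounded[OF that] kernel.centred_abs_le[OF 0 X_in_space[OF that]]
    by (intro mult_mono) auto
  have int: "integrable M (\<lambda>\<omega>. Z \<omega> * h (X j \<omega>))"
    by (rule bounded_integrable[OF _ le]) measurable
  have "\<bar>\<integral>\<omega>. Z \<omega> * h (X j \<omega>) \<partial>M\<bar> \<le> (\<integral>\<omega>. \<bar>Z \<omega> * h (X j \<omega>)\<bar> \<partial>M)"
    by (rule integral_abs_bound)
  also have "\<dots> \<le> (\<integral>\<omega>. D * C \<partial>M)"
    using le int by (intro integral_mono integrable_abs) auto
  finally show ?case by (simp add: prob_space)
next
  case (Suc m)
  interpret filtration "space M" F by (rule filtration)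
  \<comment> \<open>What is known at time \<open>j\<close> is known at time \<open>j + m\<close>, so
    \<open>Z\<close> may serve as the weight there.\<close>
  have "Z \<in> borel_measurable (F (j + m))"
    using sets_F_mono[of j "j + m"] Z by (auto simp: measurable_def space_F)
  then have "(\<integral>\<omega>. Z \<omega> * h (X (j + Suc m) \<omega>) \<partial>M)
      = (\<integral>\<omega>. Z \<omega> * kernel_op (K (j + m)) h (X (j + m) \<omega>) \<partial>M)"
    using integral_transition[OF _ Z_bounded Suc.prems] by simp
  then show ?case
    using Suc.IH[OF kernel.centred_kernel_op[OF Suc.prems, of "j + m"]]
    by (simp add: mult.assoc)
qed

text \<open>Adding the newest term to the sum adds twice its correlations with the past, at most
  \<open>2 * C\<^sup>2 / (1 - \<beta>)\<close> by the geometric series, and its own square, at most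
  \<open>C\<^sup>2\<close>. Together these are at most \<open>3 * C\<^sup>2 / (1 - \<beta>)\<close>,
  whatever \<open>n\<close> is.\<close>

lemma second_moment_le:
  assumes h: "\<And>k. centred \<pi> C (h k)"
  shows "(\<integral>\<omega>. (\<Sum>k=1..n. h k (X k \<omega>))\<^sup>2 \<partial>M) \<le> n * (3 * C\<^sup>2 / (1 - \<beta>))"
proof (induction n)
  case (Suc n)
  define Y where "Y k \<omega> = h k (X k \<omega>)" for k \<omega>
  have Y_F: "Y k \<in> borel_measurable (F k)" for k
    unfolding Y_def by (rule measurable_compose[OF adapted kernel.centred_measurable[OF h]])
  have Y_M[measurable]: "Y k \<in> borel_measurable M" for k
    using subalgebra Y_F by (rule measurable_from_subalg)
  have Y_le: "\<bar>Y k \<omega>\<bar> \<le> C" if "\<omega> \<in> space M" for k \<omega>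
    unfolding Y_def by (rule kernel.centred_abs_le[OF h X_in_space[OF that]])
  have YY_le: "\<bar>Y j \<omega> * Y k \<omega>\<bar> \<le> C\<^sup>2" if "\<omega> \<in> space M" for j k \<omega>
    unfolding abs_mult power2_eq_square
    using Y_le[OF that, of j] Y_le[OF that, of k] by (intro mult_mono) auto
  have int: "integrable M (\<lambda>\<omega>. Y j \<omega> * Y k \<omega>)" for j k
    by (rule bounded_integrable[OF _ YY_le]) measurable
  have corr: "(\<integral>\<omega>. Y j \<omega> * Y (Suc n) \<omega> \<partial>M) \<le> C\<^sup>2 * \<beta> ^ (Suc n - j)" if "j \<le> Suc n" for j
    using correlation_decay[OF Y_F[of j] Y_le h[of "Suc n"], where m = "Suc n - j"] that
    by (simp add: Y_def power2_eq_square abs_le_iff)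
  have \<beta>: "0 \<le> \<beta>" "\<beta> < 1" using kernel.nonneg kernel.less_1 by auto
  \<comment> \<open>The time lag \<open>i = Suc n - j\<close> is the new index.\<close>
  have "(\<Sum>j=1..n. \<beta> ^ (Suc n - j)) \<le> (\<Sum>i\<in>{..<Suc n}. \<beta> ^ i)"
    using \<beta> by (intro sum_le_included[where i = "\<lambda>i. Suc n - i"]) (auto intro!: bexI)
  also have "\<dots> \<le> 1 / (1 - \<beta>)"
    using sum_le_suminf[of "\<lambda>i. \<beta> ^ i" "{..<Suc n}"] \<beta> suminf_geometric[of \<beta>] by simp
  finally have geo: "(\<Sum>j=1..n. \<beta> ^ (Suc n - j)) \<le> 1 / (1 - \<beta>)" .
  have sq: "(\<Sum>k=1..Suc n. Y k \<omega>)\<^sup>2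
      = (\<Sum>k=1..n. Y k \<omega>)\<^sup>2 + (2 * (\<Sum>j=1..n. Y j \<omega> * Y (Suc n) \<omega>) + Y (Suc n) \<omega> * Y (Suc n) \<omega>)" for \<omega>
    by (simp add: power2_eq_square algebra_simps sum_distrib_left)
  have int_sq: "integrable M (\<lambda>\<omega>. (\<Sum>k=1..n. Y k \<omega>)\<^sup>2)"
    unfolding power2_eq_square sum_product using int by simp
  have "(\<integral>\<omega>. (\<Sum>k=1..Suc n. Y k \<omega>)\<^sup>2 \<partial>M)
      = (\<integral>\<omega>. (\<Sum>k=1..n. Y k \<omega>)\<^sup>2 \<partial>M)
        + (2 * (\<Sum>j=1..n. \<integral>\<omega>. Y j \<omega> * Y (Suc n) \<omega> \<partial>M) + (\<integral>\<omega>. Y (Suc n) \<omega> * Y (Suc n) \<omega> \<partial>M))"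
    unfolding sq using int int_sq by simp
  also have "\<dots> \<le> n * (3 * C\<^sup>2 / (1 - \<beta>)) + (2 * (\<Sum>j=1..n. C\<^sup>2 * \<beta> ^ (Suc n - j)) + C\<^sup>2)"
    using corr corr[of "Suc n"] Suc.IH
    by (intro add_mono mult_left_mono sum_mono) (auto simp: Y_def)
  also have "2 * (\<Sum>j=1..n. C\<^sup>2 * \<beta> ^ (Suc n - j)) + C\<^sup>2 \<le> 3 * C\<^sup>2 / (1 - \<beta>)"
  proof -
    have "1 \<le> 1 / (1 - \<beta>)" using \<beta> by simp
    then have "C\<^sup>2 * (2 * (\<Sum>j=1..n. \<beta> ^ (Suc n - j)) + 1) \<le> C\<^sup>2 * (3 * (1 / (1 - \<beta>)))"
      using geo by (intro mult_left_mono) auto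
    then show ?thesis by (simp add: sum_distrib_left algebra_simps)
  qed
  finally have "(\<integral>\<omega>. (\<Sum>k=1..Suc n. Y k \<omega>)\<^sup>2 \<partial>M)
      \<le> n * (3 * C\<^sup>2 / (1 - \<beta>)) + 3 * C\<^sup>2 / (1 - \<beta>)" by simp
  also have "\<dots> = Suc n * (3 * C\<^sup>2 / (1 - \<beta>))"
    by (simp only: of_nat_Suc distrib_right mult_1_left add.commute)
  finally show ?case by (simp only: Y_def)
qed simp

text \<open>Chebyshev's inequality divides a second moment of order \<open>n\<close> by
  \<open>(n * \<epsilon>)\<^sup>2\<close>, leaving \<open>c / n\<close>. The functions may vary with
  time, as the constant \<open>C\<close> is common to all of them.\<close>

lemma weak_law:
  assumes h: "\<And>k. centred \<pi> C (h k)"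
  shows "conv_in_prob M (\<lambda>n \<omega>. (\<Sum>k=1..n. h k (X k \<omega>)) / real n) 0"
  unfolding conv_in_prob_def
proof (intro conjI allI impI)
  note [measurable] = kernel.centred_measurable[OF h]
  define T where "T n \<omega> = (\<Sum>k=1..n. h k (X k \<omega>))" for n \<omega>
  have T_meas[measurable]: "T n \<in> borel_measurable M" for n
    unfolding T_def by measurable
  show "(\<lambda>\<omega>. (\<Sum>k=1..n. h k (X k \<omega>)) / real n) \<in> borel_measurable M" for n
    by measurable
  have int: "integrable M (\<lambda>\<omega>. (T n \<omega>)\<^sup>2)" for n
  proof (rule bounded_integrable)
    fix \<omega> assume \<omega>: "\<omega> \<in> space M"
    have "\<bar>T n \<omega>\<bar> \<le> (\<Sum>k=1..n. C)"
      unfolding T_def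
      by (intro order_trans[OF sum_abs] sum_mono kernel.centred_abs_le[OF h X_in_space[OF \<omega>]])
    then show "\<bar>(T n \<omega>)\<^sup>2\<bar> \<le> (real n * C)\<^sup>2"
      using power_mono[of "\<bar>T n \<omega>\<bar>" "real n * C" 2] by simp
  qed measurable
  fix \<epsilon> :: real assume \<epsilon>: "0 < \<epsilon>"
  define c where "c = 3 * C\<^sup>2 / (1 - \<beta>) / \<epsilon>\<^sup>2"
  have bound: "measure M {\<omega> \<in> space M. \<bar>T n \<omega> / real n - 0\<bar> > \<epsilon>} \<le> c / real n" if n: "n > 0" for n
  proof -
    have "measure M {\<omega> \<in> space M. \<bar>T n \<omega> / real n - 0\<bar> > \<epsilon>}
        \<le> measure M {\<omega> \<in> space M. \<bar>T n \<omega>\<bar> \<ge> real n * \<epsilon>}"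
      using n by (intro finite_measure_mono) (auto simp: field_simps)
    also have "\<dots> \<le> (\<integral>\<omega>. (T n \<omega>)\<^sup>2 \<partial>M) / (real n * \<epsilon>)\<^sup>2"
      using int n \<epsilon> by (intro second_moment_method) auto
    also have "\<dots> \<le> (n * (3 * C\<^sup>2 / (1 - \<beta>))) / (real n * \<epsilon>)\<^sup>2"
      using second_moment_le[where h = h, OF h, of n]
      by (intro divide_right_mono) (auto simp: T_def)
    also have "\<dots> = c / real n"
      using n by (simp add: c_def power_mult_distrib power2_eq_square)
    finally show ?thesis .
  qed
  have "(\<lambda>n. measure M {\<omega> \<in> space M. \<bar>T n \<omega> / real n - 0\<bar> > \<epsilon>}) \<longlonglongrightarrow> 0"
  proof (rule tendsto_sandwich[OF _ _ tendsto_const lim_const_over_n[of c]])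
    show "\<forall>\<^sub>F n in sequentially. measure M {\<omega> \<in> space M. \<bar>T n \<omega> / real n - 0\<bar> > \<epsilon>} \<le> c / real n"
      using eventually_gt_at_top[of 0] by eventually_elim (rule bound)
  qed auto
  then show "(\<lambda>n. measure M {\<omega> \<in> space M. \<bar>(\<Sum>k=1..n. h k (X k \<omega>)) / real n - 0\<bar> > \<epsilon>}) \<longlonglongrightarrow> 0"
    by (simp add: T_def)
qed

end

section \<open>Application to the Poisson solutions and to \<open>\<phi>\<close>\<close>

text \<open>The equation is asked for positive \<open>n\<close> only: division by zero makes an
  average at \<open>n = 0\<close> equal to 0, and there adding \<open>c\<close> would break
  it.\<close>

lemma conv_in_prob_shift:
  assumes Z: "conv_in_prob M Z 0"
    and meas: "\<And>n. Z' n \<in> borel_measurable M"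
    and eq: "\<And>n \<omega>. 0 < n \<Longrightarrow> \<omega> \<in> space M \<Longrightarrow> Z' n \<omega> = Z n \<omega> + c"
  shows "conv_in_prob M Z' c"
  unfolding conv_in_prob_def
proof (intro conjI allI impI meas)
  fix \<epsilon> :: real assume "0 < \<epsilon>"
  then have "(\<lambda>n. measure M {\<omega> \<in> space M. \<bar>Z n \<omega> - 0\<bar> > \<epsilon>}) \<longlonglongrightarrow> 0"
    using Z by (simp add: conv_in_prob_def)
  moreover have "\<forall>\<^sub>F n in sequentially. measure M {\<omega> \<in> space M. \<bar>Z n \<omega> - 0\<bar> > \<epsilon>}
      = measure M {\<omega> \<in> space M. \<bar>Z' n \<omega> - c\<bar> > \<epsilon>}"
    using eventually_gt_at_top[of 0]
    by eventually_elim (intro arg_cong[where f = "measure M"], use eq in auto)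
  ultimately show "(\<lambda>n. measure M {\<omega> \<in> space M. \<bar>Z' n \<omega> - c\<bar> > \<epsilon>}) \<longlonglongrightarrow> 0"
    by (rule Lim_transform_eventually)
qed

lemma prob_algebra_cong: "sets M = sets N \<Longrightarrow> prob_algebra M = prob_algebra N"
  by (simp add: prob_algebra_def subprob_algebra_cong[of M N])

theorem proposition23:
  fixes MX :: "'x measure" and MS :: "'s measure"
    and \<pi> :: "'x measure" and P :: "'s \<Rightarrow> 'x \<Rightarrow> 'x measure"
    and M :: "'w measure" and F :: "nat \<Rightarrow> 'w measure"
    and S :: "nat \<Rightarrow> 'w \<Rightarrow> 's" and X :: "nat \<Rightarrow> 'w \<Rightarrow> 'x"
    and s :: "nat \<Rightarrow> 's" and \<phi> :: "'x \<Rightarrow> real"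
    and A :: "nat \<Rightarrow> 'w \<Rightarrow> real"
  assumes pi: "prob_space \<pi>" "sets \<pi> = sets MX"
    and kernel: "\<And>t. t \<in> space MS \<Longrightarrow> P t \<in> MX \<rightarrow>\<^sub>M prob_algebra MX"
    and invariant: "\<And>t. t \<in> space MS \<Longrightarrow> \<pi> \<bind> P t = \<pi>"
    and joint_measurable: "\<And>B. B \<in> sets MX \<Longrightarrow>
      (\<lambda>(t, x). measure (P t x) B) \<in> borel_measurable (MS \<Otimes>\<^sub>M MX)"
    and M: "prob_space M"
    and filtration: "filtration (space M) F" "\<And>k. subalgebra M (F k)"
    and adapted: "\<And>k. S k \<in> F k \<rightarrow>\<^sub>M MS" "\<And>k. X k \<in> F k \<rightarrow>\<^sub>M MX"
    and transition: "\<And>k B. B \<in> sets MX \<Longrightarrow>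
      AE \<omega> in M. real_cond_exp M (F k) (\<lambda>\<omega>. indicator B (X (Suc k) \<omega>)) \<omega>
        = measure (P (S k \<omega>) (X k \<omega>)) B"
    and dobrushin: "\<exists>\<beta><1. \<forall>t\<in>space MS.
      (SUP (x, y)\<in>space MX \<times> space MX. tv_dist (P t x) (P t y)) \<le> \<beta>"
    and deterministic: "\<And>k. s k \<in> space MS" "\<And>k \<omega>. \<omega> \<in> space M \<Longrightarrow> S k \<omega> = s k"
    and phi: "\<phi> \<in> borel_measurable MX" "bounded (\<phi> ` space MX)"
  defines "A \<equiv> \<lambda>n \<omega>. \<Sum>k=1..n. poisson_sol \<pi> P \<phi> (S k \<omega>) (X k \<omega>)
      - poisson_sol \<pi> P \<phi> (S (k - 1) \<omega>) (X k \<omega>)"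
  shows "conv_in_prob M (\<lambda>n \<omega>. A n \<omega> / real n) 0 \<and>
    conv_in_prob M (\<lambda>n \<omega>. (\<Sum>k=1..n. \<phi> (X k \<omega>)) / real n) (\<integral>x. \<phi> x \<partial>\<pi>)"
proof -
  interpret \<pi>: prob_space \<pi> by (rule pi)
  interpret M: prob_space M by (rule M)
  note [measurable_cong] = pi(2)
  have sp: "space \<pi> = space MX" using pi(2) by (rule sets_eq_imp_space_eq)
  from dobrushin obtain \<beta> where \<beta>: "\<beta> < 1"
    and sup: "\<And>t. t \<in> space MS \<Longrightarrow>
      (SUP (x, y)\<in>space MX \<times> space MX. tv_dist (P t x) (P t y)) \<le> \<beta>"
    by blast
  have contr: "contracting_kernel \<pi> (P t) \<beta>" if t: "t \<in> space MS" for t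
  proof (unfold_locales)
    show "P t \<in> \<pi> \<rightarrow>\<^sub>M prob_algebra \<pi>"
      using kernel[OF t] by (simp add: prob_algebra_cong[OF pi(2)] measurable_cong_sets[OF pi(2) refl])
    show "\<pi> \<bind> P t = \<pi>" by (rule invariant[OF t])
    have prob: "prob_space (P t x)" if "x \<in> space MX" for x
      using measurable_space[OF kernel[OF t] that] by (simp add: space_prob_algebra)
    \<comment> \<open>The hypothesis on the supremum yields pointwise bounds because distances of
      probability measures are at most 1.\<close>
    have "bdd_above ((\<lambda>(x, y). tv_dist (P t x) (P t y)) ` (space MX \<times> space MX))"
      by (rule bdd_aboveI2[of _ _ 1]) (auto intro!: tv_dist_le_1 prob)
    then show "tv_dist (P t x) (P t y) \<le> \<beta>" if "x \<in> space \<pi>" "y \<in> space \<pi>" for x y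
      using cSUP_upper[of "(x, y)" "space MX \<times> space MX" "\<lambda>(x, y). tv_dist (P t x) (P t y)"]
        sup[OF t] that by (simp add: sp)
  qed (rule \<beta>)
  interpret chain: contracting_chain M \<pi> "\<lambda>k. P (s k)" \<beta> F X
  proof (intro contracting_chain.intro contracting_chain_axioms.intro M filtration)
    show "contracting_kernel \<pi> (P (s k)) \<beta>" for k
      by (rule contr[OF deterministic(1)])
    show "X k \<in> F k \<rightarrow>\<^sub>M \<pi>" for k
      using adapted(2) by (simp add: measurable_cong_sets[OF refl pi(2)])
    show "AE \<omega> in M. real_cond_exp M (F k) (\<lambda>\<omega>. indicator B (X (Suc k) \<omega>)) \<omega>
        = measure (P (s k) (X k \<omega>)) B" if "B \<in> sets \<pi>" for k B
    proof -
      have "B \<in> sets MX" using that pi(2) by simp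
      from transition[OF this, of k] AE_space show ?thesis
        by eventually_elim (simp add: deterministic(2))
    qed
  qed
  note X_meas[measurable] = chain.X_measurable
  define c where "c = (\<integral>x. \<phi> x \<partial>\<pi>)"
  define \<phi>c where "\<phi>c x = \<phi> x - c" for x
  have \<phi>_meas[measurable]: "\<phi> \<in> borel_measurable \<pi>"
    using phi(1) by (simp add: measurable_cong_sets[OF pi(2) refl])
  obtain B where B: "\<And>x. x \<in> space \<pi> \<Longrightarrow> \<bar>\<phi> x\<bar> \<le> B"
    using phi(2) by (auto simp: bounded_iff sp)
  have centred_\<phi>c: "centred \<pi> (2 * B) \<phi>c"
    unfolding centred_def
  proof (intro conjI ballI)
    show "\<phi>c \<in> borel_measurable \<pi>" unfolding \<phi>c_def by measurable
    show "\<bar>\<phi>c x - \<phi>c y\<bar> \<le> 2 * B" if "x \<in> space \<pi>" "y \<in> space \<pi>" for x y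
      using B[OF that(1)] B[OF that(2)] by (simp add: \<phi>c_def)
    have "integrable \<pi> \<phi>"
      using B by (intro \<pi>.integrable_const_bound[of _ B]) auto
    then show "(\<integral>x. \<phi>c x \<partial>\<pi>) = 0"
      by (simp add: \<phi>c_def c_def \<pi>.prob_space)
  qed
  define g where "g k = poisson_sol \<pi> P \<phi> (s k)" for k
  \<comment> \<open>The summands have constants \<open>2 * B * \<beta> ^ j\<close>, and the
    resulting bound is the same for all \<open>k\<close>.\<close>
  have centred_g: "centred \<pi> (2 * B / (1 - \<beta>)) (g k)" for k
  proof -
    have "g k = (\<lambda>x. \<Sum>j. (kernel_op (P (s k)) ^^ j) \<phi>c x)"
      by (simp add: g_def poisson_sol_def fun_eq_iff \<phi>c_def[abs_def] c_def)
    then show ?thesis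
      using \<pi>.centred_suminf[OF chain.kernel.centred_kernel_op_funpow[OF centred_\<phi>c]
          chain.kernel.nonneg \<beta>] by simp
  qed
  \<comment> \<open>Truncated subtraction makes \<open>h 0\<close> vanish; the sums start at 1,
    where \<open>k - 1\<close> is the true predecessor.\<close>
  define h where "h k x = g k x - g (k - 1) x" for k x
  have "centred \<pi> (2 * B / (1 - \<beta>) + 2 * B / (1 - \<beta>)) (h k)" for k
    unfolding h_def[abs_def] by (rule \<pi>.centred_diff[OF centred_g centred_g])
  then have lln_h: "conv_in_prob M (\<lambda>n \<omega>. (\<Sum>k=1..n. h k (X k \<omega>)) / real n) 0"
    by (rule chain.weak_law)
  have A_eq: "A n \<omega> / real n = (\<Sum>k=1..n. h k (X k \<omega>)) / real n" if "\<omega> \<in> space M" for n \<omega>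
    by (simp add: A_def h_def g_def deterministic(2)[OF that])
  have "conv_in_prob M (\<lambda>n \<omega>. A n \<omega> / real n) 0"
  proof (rule conv_in_prob_shift[OF lln_h])
    show "(\<lambda>\<omega>. A n \<omega> / real n) \<in> borel_measurable M" for n
      by (rule measurable_cong[OF A_eq, THEN iffD2]) (use lln_h in \<open>simp_all add: conv_in_prob_def\<close>)
  qed (simp add: A_eq)
  \<comment> \<open>Here the weak law is applied to the constant sequence of functions
    \<open>\<phi>c\<close>, and the shift restores the mean \<open>c\<close>.\<close>
  moreover have "conv_in_prob M (\<lambda>n \<omega>. (\<Sum>k=1..n. \<phi> (X k \<omega>)) / real n) c"
  proof (rule conv_in_prob_shift[OF chain.weak_law[OF centred_\<phi>c]])
    show "(\<lambda>\<omega>. (\<Sum>k=1..n. \<phi> (X k \<omega>)) / real n) \<in> borel_measurable M" for n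
      by measurable
    show "(\<Sum>k=1..n. \<phi> (X k \<omega>)) / real n = (\<Sum>k=1..n. \<phi>c (X k \<omega>)) / real n + c"
      if "0 < n" for n \<omega>
      using that by (simp add: \<phi>c_def sum_subtractf diff_divide_distrib)
  qed
  ultimately show ?thesis by (simp add: c_def)
qed

end
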